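(* For every odd integer $q\ge3$, $$\liminf_{r\to\infty}R_q(r)=1,\qquad \limsup_{r\to\infty}R_q(r)=\frac{\alpha_q}{\alpha_q-1}.$$ The value $R_q(r)=1$ occurs exactly at $r\in\mathcal L_q$. At every $r\in\mathcal U_q$, $$R_q(r)=\frac{m_r(q)}{m_r(q)-r+1},$$ and these values tend to $\alpha_q/(\alpha_q-1)$ as $r\to\infty$ along $\mathcal U_q$. In fact $$R_q(r)<\frac{\alpha_q}{\alpha_q-1}\qquad(r\ge1).$$
   Context: For an odd integer $q\ge3$ put $\alpha_q=\log_2 q$ (irrational) and $m_r(q)=\lfloor r\alpha_q\rfloor$. A $q$-admissible word of order $r\ge1$ is a finite word $w=(x_1,\dots,x_L)$ with each $x_j\in\{q/2,\,1/2\}$, containing exactly $r$ occurrences of $q/2$, such that $\prod_{j=1}^{\ell}x_j>1$ for all $1\le \ell<L$ and $\prod_{j=1}^{L}x_j<1$. Let $a_q(r)$ be the number of $q$-admissible words of order $r$, and define $$R_q(r)=\frac{r\,a_q(r)}{\binom{m_r(q)-1}{r-1}}.$$ Write the simple continued fraction $\alpha_q=[a_0;a_1,a_2,\dots]$ and let $Q_k$ be the denominator of its $k$-th convergent, with $Q_{-1}=0$, $Q_0=1$, $Q_{k+1}=a_{k+1}Q_k+Q_{k-1}$ for $k\ge0$. Set $$\mathcal L_q=\{sQ_k+Q_{k-1}: k\ge1\text{ odd},\ 0\le s<a_{k+1}\},$$ $$\mathcal U_q=\{sQ_k+Q_{k-1}: k\ge0\text{ even},\ 0\le s<a_{k+1},\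 (k,s)\ne(0,0)\}.$$ *)

theory Defs
  imports "HOL-Analysis.Analysis"
begin

definition alpha_q :: "nat \<Rightarrow> real" where
  "alpha_q q = log 2 (real q)"

definition m_q :: "nat \<Rightarrow> nat \<Rightarrow> nat" where
  "m_q q r = nat \<lfloor>real r * alpha_q q\<rfloor>"

definition admissible :: "nat \<Rightarrow> nat \<Rightarrow> real list \<Rightarrow> bool" where
  "admissible q r w \<longleftrightarrow>
     set w \<subseteq> {real q / 2, 1 / 2} \<and>
     count_list w (real q / 2) = r \<and>
     (\<forall>l. 1 \<le> l \<and> l < length w \<longrightarrow> prod_list (take l w) > 1) \<and>
     prod_list w < 1"

(* For odd q \<ge> 3 and r \<ge> 1 every admissible word has length m_q q r + 1, so the set is finite
   and card is the genuine number of words. *)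
definition a_q :: "nat \<Rightarrow> nat \<Rightarrow> nat" where
  "a_q q r = card {w. admissible q r w}"

(* For q \<ge> 3 and r \<ge> 1 we have 1 \<le> r \<le> m_q q r, so neither natural subtraction truncates and
   the denominator is positive. *)
definition R_q :: "nat \<Rightarrow> nat \<Rightarrow> real" where
  "R_q q r = real r * real (a_q q r) / real ((m_q q r - 1) choose (r - 1))"

fun complete_quotient :: "real \<Rightarrow> nat \<Rightarrow> real" where
  "complete_quotient x 0 = x"
| "complete_quotient x (Suc n) = 1 / frac (complete_quotient x n)"

(* x = [cf_coeff x 0; cf_coeff x 1, cf_coeff x 2, ...]; intended for irrational x > 0 only, where
   the expansion does not terminate and all coefficients are natural numbers. *)
definition cf_coeff :: "real \<Rightarrow> nat \<Rightarrow> nat" where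
  "cf_coeff x n = nat \<lfloor>complete_quotient x n\<rfloor>"

(* The index is shifted by one, since the recursion starts at index -1. *)
fun cf_denom_shift :: "real \<Rightarrow> nat \<Rightarrow> nat" where
  "cf_denom_shift x 0 = 0"
| "cf_denom_shift x (Suc 0) = 1"
| "cf_denom_shift x (Suc (Suc n)) =
     cf_coeff x (Suc n) * cf_denom_shift x (Suc n) + cf_denom_shift x n"

(* Denominator of the k-th convergent, for k \<ge> -1. *)
definition cf_denom :: "real \<Rightarrow> int \<Rightarrow> nat" where
  "cf_denom x k = cf_denom_shift x (nat (k + 1))"

definition lower_indices :: "nat \<Rightarrow> nat set" where
  "lower_indices q =
     {s * cf_denom (alpha_q q) (int k) + cf_denom (alpha_q q) (int k - 1) | s k.
        k \<ge> 1 \<and> odd k \<and> s < cf_coeff (alpha_q q) (k + 1)}"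

definition upper_indices :: "nat \<Rightarrow> nat set" where
  "upper_indices q =
     {s * cf_denom (alpha_q q) (int k) + cf_denom (alpha_q q) (int k - 1) | s k.
        even k \<and> s < cf_coeff (alpha_q q) (k + 1) \<and> (k, s) \<noteq> (0, 0)}"

end

theory Submission
  imports Defs
begin

text \<open>
  Let \<open>x = log 2 q\<close> and \<open>m = \<lfloor>r x\<rfloor>\<close>. Taking logarithms, an admissible word is a path with steps
  \<open>x - 1\<close> and \<open>-1\<close> that stays positive until its last step. It has \<open>m + 1\<close> letters, the last
  one is \<open>1/2\<close>, and its first \<open>m\<close> letters form a path with positive partial sums.

  Count pairs of a word of length \<open>m\<close> with \<open>r\<close> up-steps and a positive rotation of it. Every such word
  has at least one positive rotation, since its total \<open>r x - m\<close> is positive, whence \<open>R r \<ge> 1\<close>.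
  Two positive rotations of the same word cut it into pieces of positive total, one of which has some
  \<open>j < r\<close> up-steps and total less than \<open>frac (r x)\<close>. So equality holds iff \<open>frac (r x)\<close> is a strict
  minimum among the \<open>frac (j x)\<close> with \<open>1 \<le> j \<le> r\<close>.

  Among words of length \<open>m + 1\<close>, whose total is negative, at most one rotation is admissible, and exactly
  one is if \<open>frac (r x)\<close> is a strict maximum. This yields \<open>R r \<le> m / (m - r + 1) < x / (x - 1)\<close>, with
  equality in the first place at the maxima. The minima and maxima are found by the classical
  theory of one-sided best approximation: they are attained at the intermediate convergents.
\<close>

section \<open>Words and their rotations\<close>

text \<open>For \<open>x = log 2 q\<close>, with \<open>True\<close> standing for \<open>q/2\<close>
  and \<open>False\<close> for \<open>1/2\<close>, this is the base-2 logarithm of the product of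
  the letters.\<close>

definition hgt :: "real \<Rightarrow> bool list \<Rightarrow> real" where
  "hgt x w = x * real (count_list w True) - real (length w)"

definition words :: "nat \<Rightarrow> nat \<Rightarrow> bool list set" where
  "words n r = {w. length w = n \<and> count_list w True = r}"

definition positive_word :: "real \<Rightarrow> bool list \<Rightarrow> bool" where
  "positive_word x w \<longleftrightarrow> (\<forall>k. 1 \<le> k \<and> k \<le> length w \<longrightarrow> hgt x (take k w) > 0)"

definition first_passage :: "real \<Rightarrow> bool list \<Rightarrow> bool" where
  "first_passage x w \<longleftrightarrow> (\<forall>k. 1 \<le> k \<and> k < length w \<longrightarrow> hgt x (take k w) > 0) \<and> hgt x w < 0"

lemma hgt_simps [simp]:
  "hgt x [] = 0" "hgt x (b # w) = hgt x w + (if b then x - 1 else -1)"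
  by (simp_all add: hgt_def algebra_simps)

lemma hgt_append [simp]: "hgt x (u @ v) = hgt x u + hgt x v"
  by (simp add: hgt_def algebra_simps)

lemma hgt_words: "w \<in> words n r \<Longrightarrow> hgt x w = x * real r - real n"
  by (simp add: words_def hgt_def)

text \<open>Reads the partial heights of every rotation off the single walk of \<open>w\<close>, so
  that rotations can be compared; the second case wraps past the end of \<open>w\<close>.\<close>

lemma hgt_take_rotate:
  assumes "i < length w" "k \<le> length w"
  shows "hgt x (take k (rotate i w)) =
    (if i + k \<le> length w then hgt x (take (i + k) w)
     else hgt x w + hgt x (take (i + k - length w) w)) - hgt x (take i w)"
proof -
  have rot: "rotate i w = drop i w @ take i w"
    using assms by (simp add: rotate_drop_take)
  have whole: "hgt x w = hgt x (take i w) + hgt x (drop i w)"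
    by (metis hgt_append append_take_drop_id)
  show ?thesis
  proof (cases "i + k \<le> length w")
    case True
    then have "take k (rotate i w) = take k (drop i w)"
      by (simp add: rot)
    then show ?thesis
      using True by (simp add: take_add)
  next
    case False
    then have le: "k - (length w - i) = i + k - length w" "i + k - length w \<le> i"
      using assms by auto
    have "take k (rotate i w) = drop i w @ take (k - (length w - i)) (take i w)"
      using False by (simp add: rot)
    also have "\<dots> = drop i w @ take (i + k - length w) w"
      unfolding le(1) using le(2) by (simp add: min_absorb1)
    finally have "take k (rotate i w) = drop i w @ take (i + k - length w) w" .
    then show ?thesis
      using False whole by simp
  qed
qed

section \<open>Words with a given length and number of up-steps\<close>

lemma finite_words [simp]: "finite (words n r)"
proof (rule finite_subset)
  show "words n r \<subseteq> {w. set w \<subseteq> UNIV \<and> length w = n}"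
    by (auto simp: words_def)
qed (simp only: finite_lists_length_eq finite)

lemma words_Suc:
  "words (Suc n) r = (if r = 0 then {} else (#) True ` words n (r - 1)) \<union> (#) False ` words n r"
proof (rule set_eqI)
  fix w :: "bool list"
  show "w \<in> words (Suc n) r \<longleftrightarrow>
    w \<in> (if r = 0 then {} else (#) True ` words n (r - 1)) \<union> (#) False ` words n r"
  proof (cases w)
    case (Cons b v)
    then show ?thesis by (cases b) (auto simp: words_def)
  qed (auto simp: words_def)
qed

lemma card_words: "card (words n r) = n choose r"
proof (induction n arbitrary: r)
  case 0
  then show ?case
  proof (cases r)
    case 0
    then have "words 0 r = {[]}" by (auto simp: words_def)
    then show ?thesis using 0 by simp
  next
    case (Suc s)
    then have "words 0 r = {}" by (auto simp: words_def)
    then show ?thesis using Suc by simp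
  qed
next
  case (Suc n)
  show ?case
  proof (cases r)
    case 0
    have "words (Suc n) 0 = (#) False ` words n 0"
      by (simp add: words_Suc)
    then show ?thesis
      using 0 Suc.IH[of 0] by (simp add: card_image)
  next
    case (Suc s)
    have "words (Suc n) (Suc s) = (#) True ` words n s \<union> (#) False ` words n (Suc s)"
      by (simp add: words_Suc)
    moreover have "(#) True ` words n s \<inter> (#) False ` words n (Suc s) = {}"
      by auto
    ultimately show ?thesis
      using Suc Suc.IH by (simp add: card_Un_disjoint card_image)
  qed
qed

section \<open>Counting rotations and the cycle lemma\<close>

lemma count_list_rotate1 [simp]: "count_list (rotate1 w) a = count_list w a"
  by (cases w) auto

lemma count_list_rotate [simp]: "count_list (rotate i w) a = count_list w a"
  by (induction i) simp_all

lemma rotate_words: "w \<in> words n r \<Longrightarrow> rotate i w \<in> words n r"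
  by (simp add: words_def)

lemma bij_betw_rotate_words: "bij_betw (rotate i) (words n r) (words n r)"
proof -
  have "inj_on (rotate i) (words n r)"
  proof (rule inj_onI)
    fix u v :: "bool list"
    assume uv: "u \<in> words n r" "v \<in> words n r" "rotate i u = rotate i v"
    \<comment> \<open>Together with \<open>i\<close> this rotates by \<open>n * i\<close>, a
      multiple of the length.\<close>
    define j where "j = n * i - i"
    have "rotate j (rotate i u) = rotate j (rotate i v)"
      using uv by simp
    moreover have "rotate j (rotate i w) = w" if "w \<in> words n r" for w
    proof (cases "n = 0")
      case False
      then have "j + i = n * i" by (simp add: j_def)
      then show ?thesis
        using that by (simp add: rotate_rotate words_def rotate_id)
    qed (use that in \<open>simp add: words_def\<close>)
    ultimately show "u = v" using uv by metis
  qed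
  moreover have "rotate i ` words n r \<subseteq> words n r"
    using rotate_words by blast
  ultimately show ?thesis
    by (simp add: bij_betw_def endo_inj_surj)
qed

text \<open>Double counting: each \<open>rotate i\<close> permutes \<open>words n r\<close>, so
  every index \<open>i\<close> contributes the same number of words.\<close>

lemma sum_card_rotations:
  "(\<Sum>w\<in>words n r. card {i. i < n \<and> G (rotate i w)}) = n * card {w \<in> words n r. G w}"
proof -
  have "(\<Sum>w\<in>words n r. card {i. i < n \<and> G (rotate i w)})
      = (\<Sum>w\<in>words n r. \<Sum>i<n. if G (rotate i w) then 1 else 0)"
  proof (rule sum.cong)
    fix w
    have "{i. i < n \<and> G (rotate i w)} = {..<n} \<inter> {i. G (rotate i w)}" by auto
    then show "card {i. i < n \<and> G (rotate i w)} = (\<Sum>i<n. if G (rotate i w) then 1 else 0)"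
      by (simp add: sum.If_cases)
  qed simp
  also have "\<dots> = (\<Sum>i<n. \<Sum>w\<in>words n r. if G (rotate i w) then 1 else 0)"
    by (rule sum.swap)
  also have "\<dots> = (\<Sum>i<n. \<Sum>w\<in>words n r. if G w then 1 else 0)"
    using sum.reindex_bij_betw[OF bij_betw_rotate_words, of "\<lambda>w. if G w then 1 else 0::nat"]
    by simp
  also have "\<dots> = n * card {w \<in> words n r. G w}"
    by (simp add: sum.If_cases Int_def)
  finally show ?thesis .
qed

text \<open>Cycle lemma: from a lowest point of the walk no later point is lower, and wrapping
  around only adds the nonnegative total.\<close>

lemma ex_nonneg_rotation:
  assumes "w \<noteq> []" "hgt x w \<ge> 0"
  shows "\<exists>i < length w. \<forall>k \<le> length w. hgt x (take k (rotate i w)) \<ge> 0"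
proof -
  define i where "i = arg_min_on (\<lambda>i. hgt x (take i w)) {..<length w}"
  have ne: "{..<length w} \<noteq> {}" using assms by auto
  have i: "i < length w"
    using arg_min_if_finite(1)[OF _ ne, of "\<lambda>i. hgt x (take i w)"] by (simp add: i_def)
  have min: "hgt x (take i w) \<le> hgt x (take j w)" if "j < length w" for j
    using arg_min_least[OF _ ne, of j "\<lambda>i. hgt x (take i w)"] that by (simp add: i_def)
  \<comment> \<open>The position \<open>length w\<close> is not a candidate for the minimum; this
    bound settles the case where the rotation reaches exactly that position.\<close>
  have le: "hgt x (take i w) \<le> 0"
    using min[of 0] assms by simp
  have "hgt x (take k (rotate i w)) \<ge> 0" if k: "k \<le> length w" for k
  proof (cases "i + k" "length w" rule: linorder_cases)
    case less
    then show ?thesis using min[of "i + k"] hgt_take_rotate[OF i k] by simp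
  next
    case equal
    then show ?thesis using le assms hgt_take_rotate[OF i k] by simp
  next
    case greater
    then have "i + k - length w < length w"
      using i k by linarith
    then show ?thesis using greater min[of "i + k - length w"] assms i k hgt_take_rotate[OF i k] by simp
  qed
  then show ?thesis using i by blast
qed

text \<open>Two such starting points would cut the cyclic word into two pieces of positive height,
  although the total is negative.\<close>

lemma first_passage_rotation_unique:
  assumes "i < length w" "j < length w"
    and "first_passage x (rotate i w)" "first_passage x (rotate j w)"
  shows "i = j"
proof -
  have False
    if ij: "i < j" "j < length w"
      and fi: "first_passage x (rotate i w)" and fj: "first_passage x (rotate j w)" for i j
  proof -
    have "hgt x (take (j - i) (rotate i w)) > 0"
      using fi ij by (simp add: first_passage_def Suc_le_eq)
    moreover have "hgt x (take (i + length w - j) (rotate j w)) > 0"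
      using fj ij by (simp add: first_passage_def Suc_le_eq less_diff_conv)
    moreover have "hgt x (take (length w) (rotate i w)) < 0"
      using fi by (simp add: first_passage_def)
    ultimately show False
      using ij hgt_take_rotate[of i w "j - i" x] hgt_take_rotate[of j w "i + length w - j" x]
        hgt_take_rotate[of i w "length w" x]
      by (auto split: if_splits)
  qed
  then show ?thesis
    using assms by (metis linorder_neqE_nat)
qed

text \<open>The two starting points cut the cyclic word into two pieces of positive height that add
  up to \<open>hgt x w\<close>.\<close>

lemma positive_rotations_distinct:
  assumes ij: "i < j" "j < length w"
    and "positive_word x (rotate i w)" "positive_word x (rotate j w)"
  shows "0 < hgt x (take (j - i) (rotate i w))" "hgt x (take (j - i) (rotate i w)) < hgt x w"
proof -
  show "0 < hgt x (take (j - i) (rotate i w))"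
    using assms by (simp add: positive_word_def Suc_le_eq)
  have "hgt x (take (i + length w - j) (rotate j w)) > 0"
    using assms by (simp add: positive_word_def Suc_le_eq)
  then show "hgt x (take (j - i) (rotate i w)) < hgt x w"
    using ij hgt_take_rotate[of i w "j - i" x] hgt_take_rotate[of j w "i + length w - j" x]
    by (auto split: if_splits)
qed

section \<open>Building positive words from blocks\<close>

lemma count_list_replicate [simp]: "count_list (replicate n a) b = (if a = b then n else 0)"
  by (induction n) auto

text \<open>The walk first rises and then falls, so only its final height has to be checked.\<close>

lemma positive_word_block:
  assumes "x > 1" "hgt x (replicate a True @ replicate b False) > 0"
  shows "positive_word x (replicate a True @ replicate b False)"
  unfolding positive_word_def
proof (intro allI impI)
  fix k assume k: "1 \<le> k \<and> k \<le> length (replicate a True @ replicate b False)"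
  show "0 < hgt x (take k (replicate a True @ replicate b False))"
  proof (cases "k \<le> a")
    case True
    then have "hgt x (take k (replicate a True @ replicate b False)) = (x - 1) * real k"
      by (simp add: hgt_def algebra_simps min_def)
    then show ?thesis using k assms by simp
  next
    case False
    then have "hgt x (take k (replicate a True @ replicate b False)) = x * real a - real k"
      using k by (auto simp: hgt_def min_def)
    then show ?thesis using k assms by (simp add: hgt_def)
  qed
qed

lemma positive_word_append:
  assumes "positive_word x u" "positive_word x v" "u \<noteq> []"
  shows "positive_word x (u @ v)"
  unfolding positive_word_def
proof (intro allI impI)
  fix k assume k: "1 \<le> k \<and> k \<le> length (u @ v)"
  have u: "hgt x u > 0"
    using assms(1,3) by (auto simp: positive_word_def Suc_le_eq dest: spec[of _ "length u"])
  show "0 < hgt x (take k (u @ v))"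
  proof (cases "k \<le> length u")
    case True
    then show ?thesis using k assms by (simp add: positive_word_def)
  next
    case False
    then have "hgt x (take (k - length u) v) > 0"
      using k assms(2) by (simp add: positive_word_def Suc_le_eq)
    then show ?thesis using False u by simp
  qed
qed

definition floor_mult :: "real \<Rightarrow> nat \<Rightarrow> nat" where
  "floor_mult x r = nat \<lfloor>real r * x\<rfloor>"

text \<open>Takes the place of \<open>a_q\<close>: admissible words are counted without their forced
  final letter \<open>1/2\<close>, see \<open>first_passage_words\<close>.\<close>

definition positive_count :: "real \<Rightarrow> nat \<Rightarrow> nat" where
  "positive_count x r = card {w \<in> words (floor_mult x r) r. positive_word x w}"

definition positive_ratio :: "real \<Rightarrow> nat \<Rightarrow> real" where
  "positive_ratio x r = real r * real (positive_count x r) / real ((floor_mult x r - 1) choose (r - 1))"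

text \<open>For \<open>\<sigma> = 1\<close> this is a strict minimum of
  \<open>frac (real j * x)\<close>; for \<open>\<sigma> = - 1\<close> and irrational
  \<open>x\<close> it is a strict maximum, as \<open>frac (- t) = 1 - frac t\<close> off the
  integers. The sign lets both cases share one continued fraction argument.\<close>

definition frac_record :: "real \<Rightarrow> int \<Rightarrow> nat \<Rightarrow> bool" where
  "frac_record x \<sigma> r \<longleftrightarrow>
     (\<forall>j. 1 \<le> j \<and> j < r \<longrightarrow> frac (of_int \<sigma> * (real r * x)) < frac (of_int \<sigma> * (real j * x)))"

section \<open>Positive words and record fractional parts\<close>

context
  fixes x :: real
  assumes irr: "x \<notin> \<rat>" and gt1: "x > 1"
begin

lemma mult_nat_noteq_int: "j \<ge> 1 \<Longrightarrow> real j * x \<noteq> of_int p"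
proof
  assume "j \<ge> 1" "real j * x = of_int p"
  then have "x = of_int p / real j" by (simp add: field_simps)
  then show False using irr by auto
qed

lemma floor_mult_less: "r \<ge> 1 \<Longrightarrow> real (floor_mult x r) < real r * x"
proof -
  assume r: "r \<ge> 1"
  have "real (floor_mult x r) = of_int \<lfloor>real r * x\<rfloor>"
    using gt1 by (simp add: floor_mult_def)
  then show ?thesis
    using mult_nat_noteq_int[OF r, of "\<lfloor>real r * x\<rfloor>"] of_int_floor_le[of "real r * x"] by linarith
qed

lemma less_floor_mult: "real r * x < real (floor_mult x r) + 1"
proof -
  have "real (floor_mult x r) = of_int \<lfloor>real r * x\<rfloor>"
    using gt1 by (simp add: floor_mult_def)
  then show ?thesis by linarith
qed

lemma le_floor_mult: "r \<le> floor_mult x r"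
proof -
  have "real r \<le> real r * x"
    using gt1 by (simp add: mult_le_cancel_left1)
  then show ?thesis
    unfolding floor_mult_def by (metis le_nat_floor of_nat_le_iff)
qed

lemma frac_floor_mult: "frac (real r * x) = real r * x - real (floor_mult x r)"
  using gt1 by (simp add: frac_def floor_mult_def)

lemma frac_uminus_floor_mult:
  assumes "r \<ge> 1"
  shows "frac (- (real r * x)) = real (floor_mult x r) + 1 - real r * x"
proof -
  have "real r * x \<notin> \<int>"
    using mult_nat_noteq_int[OF assms] by (auto elim: Ints_cases)
  then show ?thesis
    by (simp add: frac_neg frac_floor_mult)
qed

text \<open>Irrationality excludes ties, so weak inequalities for heights of nonempty words become
  strict.\<close>

lemma hgt_nonzero:
  assumes "w \<noteq> []"
  shows "hgt x w \<noteq> 0"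
proof
  assume 0: "hgt x w = 0"
  then have "real (count_list w True) * x = of_int (int (length w))"
    by (simp add: hgt_def mult.commute)
  moreover from 0 assms have "count_list w True \<ge> 1"
    by (cases "count_list w True = 0") (auto simp: hgt_def)
  ultimately show False using mult_nat_noteq_int by blast
qed

lemma ex_positive_rotation:
  assumes "r \<ge> 1" "w \<in> words (floor_mult x r) r"
  shows "\<exists>i < floor_mult x r. positive_word x (rotate i w)"
proof -
  have len: "length w = floor_mult x r"
    using assms by (simp add: words_def)
  then have ne: "w \<noteq> []"
    using assms le_floor_mult[of r] by auto
  have "hgt x w \<ge> 0"
    using hgt_words[OF assms(2), of x] floor_mult_less[OF assms(1)] by (simp add: mult.commute)
  then obtain i where i: "i < length w" "\<forall>k \<le> length w. hgt x (take k (rotate i w)) \<ge> 0"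
    using ex_nonneg_rotation ne by blast
  have "positive_word x (rotate i w)"
    unfolding positive_word_def
  proof (intro allI impI)
    fix k assume k: "1 \<le> k \<and> k \<le> length (rotate i w)"
    then have "take k (rotate i w) \<noteq> []"
      using ne by auto
    then show "hgt x (take k (rotate i w)) > 0"
      using i(2) k hgt_nonzero by (force simp: less_le)
  qed
  then show ?thesis
    using i(1) len by auto
qed

section \<open>Positive rotations of words of length \<open>floor_mult x r\<close>\<close>

abbreviation "positive_rotations w \<equiv> {i. i < length w \<and> positive_word x (rotate i w)}"

lemma sum_card_positive_rotations:
  "(\<Sum>w\<in>words (floor_mult x r) r. card (positive_rotations w)) = floor_mult x r * positive_count x r"
proof -
  have "(\<Sum>w\<in>words (floor_mult x r) r. card (positive_rotations w))
      = (\<Sum>w\<in>words (floor_mult x r) r. card {i. i < floor_mult x r \<and> positive_word x (rotate i w)})"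
    by (rule sum.cong) (auto simp: words_def)
  then show ?thesis
    by (simp add: sum_card_rotations positive_count_def)
qed

lemma card_positive_rotations_ge_1:
  assumes "r \<ge> 1" "w \<in> words (floor_mult x r) r"
  shows "card (positive_rotations w) \<ge> 1"
proof -
  have "length w = floor_mult x r"
    using assms by (simp add: words_def)
  then have "positive_rotations w \<noteq> {}"
    using ex_positive_rotation[OF assms] by auto
  then show ?thesis
    by (simp add: Suc_le_eq card_gt_0_iff)
qed

lemma choose_le_positive_count:
  assumes "r \<ge> 1"
  shows "floor_mult x r choose r \<le> floor_mult x r * positive_count x r"
proof -
  have "(\<Sum>w\<in>words (floor_mult x r) r. 1) \<le> (\<Sum>w\<in>words (floor_mult x r) r. card (positive_rotations w))"
    using card_positive_rotations_ge_1[OF assms] by (rule sum_mono)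
  then show ?thesis
    by (simp add: sum_card_positive_rotations card_words)
qed

text \<open>Two positive rotations would cut off a piece with \<open>c < r\<close> up-steps and
  height below \<open>frac (real r * x)\<close>. That height is at least
  \<open>frac (real c * x)\<close>, against the record.\<close>

lemma frac_record_positive_rotation_unique:
  assumes r: "r \<ge> 1" and w: "w \<in> words (floor_mult x r) r" and rec: "frac_record x 1 r"
  shows "card (positive_rotations w) \<le> 1"
proof -
  have len: "length w = floor_mult x r"
    using w by (simp add: words_def)
  have False
    if ij: "i < j" "j < length w"
      and pos: "positive_word x (rotate i w)" "positive_word x (rotate j w)" for i j
  proof -
    define u where "u = take (j - i) (rotate i w)"
    define c where "c = count_list u True"
    have "u @ drop (j - i) (rotate i w) = rotate i w"
      by (simp add: u_def)
    then have "count_list u True \<le> count_list (rotate i w) True"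
      by (metis count_list_append le_add1)
    then have c_le: "c \<le> r"
      using w by (simp add: c_def words_def)
    have lu: "length u = j - i"
      using ij by (simp add: u_def)
    have gr: "0 < x * real c - real (j - i)" "x * real c - real (j - i) < x * real r - real (floor_mult x r)"
      using positive_rotations_distinct[OF ij pos] hgt_words[OF w, of x]
      by (simp_all add: hgt_def lu flip: u_def c_def)
    have c1: "c \<ge> 1"
      using gr(1) by (cases c) auto
    \<comment> \<open>With all \<open>r\<close> up-steps the piece would have to be longer than the
      whole word.\<close>
    have "c \<noteq> r"
      using gr(2) ij len by auto
    then have "c < r" using c_le by simp
    then have "frac (real r * x) < frac (real c * x)"
      using rec c1 by (simp add: frac_record_def)
    \<comment> \<open>A positive height bounds the length of the piece by
      \<open>floor_mult x c\<close>.\<close>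
    moreover have "real (j - i) \<le> real (floor_mult x c)"
    proof -
      have "j - i \<le> floor_mult x c"
        unfolding floor_mult_def using gr(1) by (intro le_nat_floor) (simp add: mult.commute)
      then show ?thesis by simp
    qed
    ultimately show False
      using gr(2) unfolding frac_floor_mult by (simp add: mult.commute)
  qed
  then have "\<forall>i\<in>positive_rotations w. \<forall>j\<in>positive_rotations w. i = j"
    by (metis (mono_tags, lifting) linorder_neqE_nat mem_Collect_eq)
  then show ?thesis
    by (simp add: card_le_Suc0_iff_eq)
qed

text \<open>A failed record at \<open>j < r\<close> yields two positive blocks \<open>u\<close> and
  \<open>v\<close>; joined in either order they stay positive, so the rotations of
  \<open>u @ v\<close> by 0 and by \<open>N\<close> both count.\<close>

lemma ex_two_positive_rotations:
  assumes r: "r \<ge> 1" and nrec: "\<not> frac_record x 1 r"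
  shows "\<exists>w\<in>words (floor_mult x r) r. card (positive_rotations w) > 1"
proof -
  obtain j where j: "1 \<le> j" "j < r" "frac (real j * x) \<le> frac (real r * x)"
    using nrec by (auto simp: frac_record_def not_less)
  define M where "M = floor_mult x r"
  define N where "N = floor_mult x j"
  have Nj: "j \<le> N" using le_floor_mult N_def by simp
  \<comment> \<open>Leaves room in \<open>v\<close> for the remaining \<open>r - j\<close>
    up-steps.\<close>
  have "real N + real (r - j) < real M + 1"
  proof -
    have "real (r - j) \<le> real (r - j) * x"
      using gt1 by (simp add: mult_le_cancel_left1)
    then have "real N + real (r - j) \<le> real j * x + real (r - j) * x"
      using floor_mult_less[OF j(1)] by (simp add: N_def)
    also have "\<dots> = real r * x"
      using j by (simp add: of_nat_diff algebra_simps)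
    finally show ?thesis
      using less_floor_mult[of r] by (simp add: M_def)
  qed
  then have NM: "N + (r - j) \<le> M" by linarith
  define u where "u = replicate j True @ replicate (N - j) False"
  define v where "v = replicate (r - j) True @ replicate (M - N - (r - j)) False"
  have lu: "length u = N" "count_list u True = j"
    using Nj by (simp_all add: u_def)
  have lv: "length v = M - N" "count_list v True = r - j"
    using NM j by (simp_all add: v_def)
  have hu: "hgt x u > 0"
    using lu floor_mult_less[OF j(1)] by (simp add: hgt_def N_def mult.commute)
  have "v \<noteq> []" using lv j by auto
  \<comment> \<open>Nonnegative by the choice of \<open>j\<close>, hence positive by
    irrationality.\<close>
  have "hgt x v = frac (real r * x) - frac (real j * x)"
    using lv j NM unfolding frac_floor_mult by (simp add: hgt_def of_nat_diff algebra_simps flip: M_def N_def)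
  then have hv: "hgt x v > 0"
    using j(3) hgt_nonzero[OF \<open>v \<noteq> []\<close>] by simp
  have pu: "positive_word x u" and pv: "positive_word x v"
    using positive_word_block[OF gt1] hu hv by (simp_all add: u_def v_def)
  have "u \<noteq> []" using lu Nj j by auto
  have "u @ v \<in> words M r"
    using lu lv NM j by (simp add: words_def)
  moreover have "{0, N} \<subseteq> positive_rotations (u @ v)"
    using positive_word_append[OF pu pv \<open>u \<noteq> []\<close>] positive_word_append[OF pv pu \<open>v \<noteq> []\<close>]
      rotate_append[of u v] lu \<open>u \<noteq> []\<close> \<open>v \<noteq> []\<close> by auto
  then have "card {0, N} \<le> card (positive_rotations (u @ v))"
    by (intro card_mono) auto
  then have "card (positive_rotations (u @ v)) > 1"
    using Nj j by simp
  ultimately show ?thesis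
    unfolding M_def by blast
qed

text \<open>Every word has at least one positive rotation, so equality of the sums means exactly one
  for each word.\<close>

lemma positive_count_eq_choose_iff:
  assumes r: "r \<ge> 1"
  shows "floor_mult x r * positive_count x r = (floor_mult x r choose r) \<longleftrightarrow> frac_record x 1 r"
proof
  let ?W = "words (floor_mult x r) r"
  assume "frac_record x 1 r"
  then have "(\<Sum>w\<in>?W. card (positive_rotations w)) = (\<Sum>w\<in>?W. 1)"
    using card_positive_rotations_ge_1[OF r] frac_record_positive_rotation_unique[OF r]
    by (intro sum.cong refl antisym) auto
  then show "floor_mult x r * positive_count x r = (floor_mult x r choose r)"
    by (simp add: sum_card_positive_rotations card_words)
next
  let ?W = "words (floor_mult x r) r"
  assume eq: "floor_mult x r * positive_count x r = (floor_mult x r choose r)"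
  show "frac_record x 1 r"
  proof (rule ccontr)
    assume "\<not> frac_record x 1 r"
    then obtain w where "w \<in> ?W" "card (positive_rotations w) > 1"
      using ex_two_positive_rotations[OF r] by blast
    then have "(\<Sum>w\<in>?W. 1) < (\<Sum>w\<in>?W. card (positive_rotations w))"
      using card_positive_rotations_ge_1[OF r] by (intro sum_strict_mono_ex1) auto
    then show False
      using eq by (simp add: sum_card_positive_rotations card_words)
  qed
qed

section \<open>First-passage words and their rotations\<close>

lemma first_passage_words:
  assumes r: "r \<ge> 1"
  shows "{w. count_list w True = r \<and> first_passage x w}
    = (\<lambda>u. u @ [False]) ` {u \<in> words (floor_mult x r) r. positive_word x u}"
proof (intro set_eqI iffI)
  fix w assume "w \<in> (\<lambda>u. u @ [False]) ` {u \<in> words (floor_mult x r) r. positive_word x u}"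
  then obtain u where u: "w = u @ [False]" "u \<in> words (floor_mult x r) r" "positive_word x u"
    by auto
  have "hgt x w < 0"
    using u(1) hgt_words[OF u(2), of x] less_floor_mult[of r] by (simp add: mult.commute)
  then show "w \<in> {w. count_list w True = r \<and> first_passage x w}"
    using u by (auto simp: words_def first_passage_def positive_word_def)
next
  fix w assume "w \<in> {w. count_list w True = r \<and> first_passage x w}"
  then have w: "count_list w True = r" "first_passage x w" by auto
  then have "w \<noteq> []" using r by auto
  then obtain u b where ub: "w = u @ [b]" by (metis rev_exhaust)
  have pu: "positive_word x u"
    using w(2) by (auto simp: ub first_passage_def positive_word_def)
  \<comment> \<open>Only a weak bound, since \<open>u\<close> may still be empty here.\<close>
  have "hgt x u \<ge> 0"
    using pu by (cases "u = []") (auto simp: positive_word_def Suc_le_eq dest: spec[of _ "length u"])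
  then have b: "\<not> b"
    using w(2) gt1 by (auto simp: ub first_passage_def)
  then have cu: "count_list u True = r"
    using w(1) by (simp add: ub)
  \<comment> \<open>These two bounds pin the length of \<open>u\<close> to the floor of
    \<open>real r * x\<close>.\<close>
  have "hgt x u \<ge> 0" "hgt x u - 1 < 0"
    using \<open>hgt x u \<ge> 0\<close> w(2) b by (auto simp: ub first_passage_def)
  then have "real (length u) \<le> real r * x" "real r * x < real (length u) + 1"
    by (simp_all add: hgt_def cu mult.commute)
  then have "\<lfloor>real r * x\<rfloor> = int (length u)"
    by (intro floor_unique) auto
  then have "length u = floor_mult x r"
    by (simp add: floor_mult_def)
  then show "w \<in> (\<lambda>u. u @ [False]) ` {u \<in> words (floor_mult x r) r. positive_word x u}"
    using pu cu b by (auto simp: ub words_def)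
qed

lemma card_first_passage_words:
  assumes "r \<ge> 1"
  shows "card {w. count_list w True = r \<and> first_passage x w} = positive_count x r"
  unfolding first_passage_words[OF assms] positive_count_def
  by (rule card_image) (auto simp: inj_on_def)

lemma sum_card_first_passage_rotations:
  assumes r: "r \<ge> 1"
  shows "(\<Sum>w\<in>words (Suc (floor_mult x r)) r. card {i. i < Suc (floor_mult x r) \<and> first_passage x (rotate i w)})
    = Suc (floor_mult x r) * positive_count x r"
proof -
  have "{w. count_list w True = r \<and> first_passage x w} \<subseteq> words (Suc (floor_mult x r)) r"
    unfolding first_passage_words[OF r] by (auto simp: words_def)
  then have "{w \<in> words (Suc (floor_mult x r)) r. first_passage x w}
    = {w. count_list w True = r \<and> first_passage x w}"
    by (auto simp: words_def)
  then show ?thesis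
    by (simp only: sum_card_rotations card_first_passage_words[OF r])
qed

lemma card_first_passage_rotations_le_1:
  assumes "w \<in> words n r"
  shows "card {i. i < n \<and> first_passage x (rotate i w)} \<le> 1"
proof -
  have "length w = n" using assms by (simp add: words_def)
  then have "\<forall>i\<in>{i. i < n \<and> first_passage x (rotate i w)}. \<forall>j\<in>{i. i < n \<and> first_passage x (rotate i w)}. i = j"
    using first_passage_rotation_unique by blast
  then show ?thesis
    by (simp add: card_le_Suc0_iff_eq)
qed

text \<open>Each word of length \<open>m + 1\<close> has at most one first-passage rotation, while
  the sum over words counts every first-passage word \<open>m + 1\<close> times.\<close>

lemma positive_count_le_choose:
  assumes r: "r \<ge> 1"
  shows "Suc (floor_mult x r) * positive_count x r \<le> (Suc (floor_mult x r) choose r)"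
proof -
  let ?W = "words (Suc (floor_mult x r)) r"
  have "(\<Sum>w\<in>?W. card {i. i < Suc (floor_mult x r) \<and> first_passage x (rotate i w)}) \<le> (\<Sum>w\<in>?W. 1)"
    by (intro sum_mono card_first_passage_rotations_le_1)
  then show ?thesis
    by (simp only: sum_card_first_passage_rotations[OF r] card_words sum_constant mult_1_right of_nat_id)
qed

text \<open>At a record, no fraction with denominator below \<open>r\<close> lies between \<open>x\<close> and
  \<open>(m + 1) / r\<close>, so words of length \<open>m + 1\<close> may be compared with the slope \<open>(m + 1) / r\<close>,
  for which the total height vanishes.\<close>

lemma ex_first_passage_rotation:
  assumes r: "r \<ge> 1" and rec: "frac_record x (- 1) r" and w: "w \<in> words (Suc (floor_mult x r)) r"
  shows "\<exists>i < Suc (floor_mult x r). first_passage x (rotate i w)"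
proof -
  define m where "m = floor_mult x r"
  define y where "y = (real m + 1) / real r"
  have len: "length w = Suc m" and cnt: "count_list w True = r"
    using w by (simp_all add: words_def m_def)
  have "w \<noteq> []" using len by auto
  moreover have "hgt y w \<ge> 0"
    using r len cnt by (simp add: hgt_def y_def)
  ultimately obtain i where i: "i < length w"
    and ge: "\<forall>k \<le> length w. hgt y (take k (rotate i w)) \<ge> 0"
    using ex_nonneg_rotation by blast
  have "first_passage x (rotate i w)"
    unfolding first_passage_def
  proof (intro conjI allI impI)
    have "rotate i w \<in> words (Suc m) r"
      using w by (simp add: rotate_words m_def)
    then show "hgt x (rotate i w) < 0"
      using hgt_words[of "rotate i w" "Suc m" r x] less_floor_mult[of r] by (simp add: m_def mult.commute)
  next
    fix k assume k: "1 \<le> k \<and> k < length (rotate i w)"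
    define u where "u = take k (rotate i w)"
    define c where "c = count_list u True"
    have lu: "length u = k" using k by (simp add: u_def)
    have "u @ drop k (rotate i w) = rotate i w"
      by (simp add: u_def)
    then have "count_list u True \<le> count_list (rotate i w) True"
      by (metis count_list_append le_add1)
    then have c_le: "c \<le> r"
      using cnt by (simp add: c_def)
    have hy: "real k \<le> y * real c"
      using ge k lu by (simp add: hgt_def u_def c_def)
    have c1: "c \<ge> 1"
      using hy k by (cases c) auto
    have "real k < x * real c"
    proof (cases "c = r")
      case True
      then show ?thesis
        using k len floor_mult_less[OF r] by (simp add: m_def mult.commute)
    next
      case False
      then have cr: "c < r" using c_le by simp
      show ?thesis
      \<comment> \<open>Otherwise \<open>frac (- (real c * x))\<close> is at most
        \<open>(y - x) * c\<close>, which is \<open>c / r\<close> times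
        \<open>frac (- (real r * x))\<close>, contradicting the record at \<open>r\<close>.\<close>
      proof (rule ccontr)
        assume "\<not> ?thesis"
        then have "real (floor_mult x c) < real k"
          using floor_mult_less[OF c1] by (simp add: mult.commute)
        then have "frac (- (real c * x)) \<le> real k - real c * x"
          by (simp add: frac_uminus_floor_mult[OF c1])
        moreover have "frac (- (real r * x)) < frac (- (real c * x))"
          using rec cr c1 by (simp add: frac_record_def)
        ultimately have "(real m + 1) - real r * x < y * real c - real c * x"
          using hy by (simp add: frac_uminus_floor_mult[OF r] m_def)
        also have "\<dots> = real c / real r * ((real m + 1) - real r * x)"
          using r by (simp add: y_def field_simps)
        also have "\<dots> \<le> 1 * ((real m + 1) - real r * x)"
          using cr less_floor_mult[of r] by (intro mult_right_mono) (auto simp: m_def)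
        finally show False by simp
      qed
    qed
    then show "hgt x (take k (rotate i w)) > 0"
      by (simp add: hgt_def lu flip: u_def c_def)
  qed
  then show ?thesis
    using i len by (auto simp: m_def)
qed

lemma frac_record_positive_count_eq_choose:
  assumes r: "r \<ge> 1" and rec: "frac_record x (- 1) r"
  shows "Suc (floor_mult x r) * positive_count x r = (Suc (floor_mult x r) choose r)"
proof -
  let ?W = "words (Suc (floor_mult x r)) r"
  let ?C = "\<lambda>w. card {i. i < Suc (floor_mult x r) \<and> first_passage x (rotate i w)}"
  have "?C w = 1" if "w \<in> ?W" for w
  proof (rule antisym)
    show "1 \<le> ?C w"
      using ex_first_passage_rotation[OF r rec that] by (auto simp: Suc_le_eq card_gt_0_iff)
  qed (rule card_first_passage_rotations_le_1[OF that])
  then have "(\<Sum>w\<in>?W. ?C w) = (\<Sum>w\<in>?W. 1)"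
    by (intro sum.cong refl)
  then show ?thesis
    by (simp only: sum_card_first_passage_rotations[OF r] card_words sum_constant mult_1_right of_nat_id)
qed

section \<open>Bounds and exact values of the ratio\<close>

lemma choose_pos:
  assumes r: "r \<ge> 1"
  shows "(floor_mult x r - 1) choose (r - 1) > 0"
  using le_floor_mult[of r] r by simp

lemma choose_absorption:
  assumes r: "r \<ge> 1"
  shows "r * (floor_mult x r choose r) = floor_mult x r * ((floor_mult x r - 1) choose (r - 1))"
  using le_floor_mult[of r] r binomial_absorption[of "r - 1" "floor_mult x r"] by simp

text \<open>Both sides equal \<open>floor_mult x r choose (r - 1)\<close>. This converts counts over
  words of length \<open>m + 1\<close> into the factor \<open>m / (m - r + 1)\<close>.\<close>

lemma choose_quotient:
  assumes r: "r \<ge> 1"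
  shows "real (Suc (floor_mult x r) choose r) * real r / real (Suc (floor_mult x r))
    = real ((floor_mult x r - 1) choose (r - 1)) * (real (floor_mult x r) / (real (floor_mult x r) - real r + 1))"
proof -
  obtain s where s: "r = Suc s" using r by (cases r) auto
  obtain n where n: "floor_mult x r = Suc n" using le_floor_mult[of r] r by (cases "floor_mult x r") auto
  have sn: "s \<le> n" using le_floor_mult[of r] s n by simp
  have "Suc s * (Suc (Suc n) choose Suc s) = Suc (Suc n) * (Suc n choose s)"
    using Suc_times_binomial[of s "Suc n"] .
  then have "real (Suc (Suc n) choose Suc s) * real (Suc s) = real (Suc (Suc n)) * real (Suc n choose s)"
    by (metis of_nat_mult mult.commute)
  then have "real (Suc (Suc n) choose Suc s) * real (Suc s) / real (Suc (Suc n)) = real (Suc n choose s)"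
    by (metis nonzero_mult_div_cancel_left of_nat_0_neq nat.distinct(1) of_nat_eq_0_iff)
  moreover have "(Suc n - s) * (Suc n choose s) = Suc n * (n choose s)"
    using binomial_absorb_comp[of "Suc n" s] by simp
  then have "(real n - real s + 1) * real (Suc n choose s) = real (Suc n) * real (n choose s)"
    using sn by (metis of_nat_mult of_nat_diff Suc_diff_le of_nat_Suc add.commute)
  then have "real (Suc n choose s) = real (n choose s) * (real (Suc n) / (real n - real s + 1))"
    using sn by (simp add: field_simps)
  ultimately show ?thesis
    by (simp add: s n[unfolded s])
qed

text \<open>By absorption the ratio is the mean number of positive rotations of a word in
  \<open>words (floor_mult x r) r\<close>.\<close>

lemma positive_ratio_altdef:
  assumes r: "r \<ge> 1"
  shows "positive_ratio x r = real (floor_mult x r * positive_count x r) / real (floor_mult x r choose r)"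
proof -
  have "real r * real (floor_mult x r choose r) = real (floor_mult x r) * real ((floor_mult x r - 1) choose (r - 1))"
    using choose_absorption[OF r] by (metis of_nat_mult)
  moreover have "real ((floor_mult x r - 1) choose (r - 1)) > 0" "real (floor_mult x r choose r) > 0"
    using choose_pos[OF r] le_floor_mult[of r] by auto
  ultimately show ?thesis
    unfolding positive_ratio_def by (simp add: field_simps)
qed

lemma positive_ratio_ge_1:
  assumes r: "r \<ge> 1"
  shows "positive_ratio x r \<ge> 1"
proof -
  have "real (floor_mult x r choose r) \<le> real (floor_mult x r * positive_count x r)"
    using choose_le_positive_count[OF r] by (rule of_nat_mono)
  moreover have "real (floor_mult x r choose r) > 0"
    using le_floor_mult[of r] by auto
  ultimately show ?thesis
    by (simp only: positive_ratio_altdef[OF r] le_divide_eq_1_pos)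
qed

lemma positive_ratio_eq_1_iff:
  assumes r: "r \<ge> 1"
  shows "positive_ratio x r = 1 \<longleftrightarrow> frac_record x 1 r"
proof -
  have "real (floor_mult x r choose r) > 0"
    using le_floor_mult[of r] by auto
  then have "positive_ratio x r = 1 \<longleftrightarrow> floor_mult x r * positive_count x r = (floor_mult x r choose r)"
    unfolding positive_ratio_altdef[OF r] by (simp only: divide_eq_1_iff of_nat_eq_iff) auto
  then show ?thesis
    using positive_count_eq_choose_iff[OF r] by simp
qed

lemma positive_ratio_le:
  assumes r: "r \<ge> 1"
  shows "positive_ratio x r \<le> real (floor_mult x r) / (real (floor_mult x r) - real r + 1)"
proof -
  let ?m = "floor_mult x r" and ?b = "real ((floor_mult x r - 1) choose (r - 1))"
  have b: "?b > 0" using choose_pos[OF r] by simp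
  have "real (Suc ?m) * real (positive_count x r) \<le> real (Suc ?m choose r)"
    using positive_count_le_choose[OF r] by (metis of_nat_le_iff of_nat_mult)
  then have "real r * real (positive_count x r) \<le> real (Suc ?m choose r) * real r / real (Suc ?m)"
    using mult_left_mono[of "real (Suc ?m) * real (positive_count x r)" "real (Suc ?m choose r)" "real r"]
    by (simp add: pos_le_divide_eq mult_ac del: of_nat_Suc)
  also note choose_quotient[OF r]
  finally show ?thesis
    using b by (simp add: positive_ratio_def pos_divide_le_eq mult_ac)
qed

lemma positive_ratio_eq:
  assumes r: "r \<ge> 1" and rec: "frac_record x (- 1) r"
  shows "positive_ratio x r = real (floor_mult x r) / (real (floor_mult x r) - real r + 1)"
proof -
  let ?m = "floor_mult x r" and ?b = "real ((floor_mult x r - 1) choose (r - 1))"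
  have b: "?b > 0" using choose_pos[OF r] by simp
  have "real (Suc ?m) * real (positive_count x r) = real (Suc ?m choose r)"
    using frac_record_positive_count_eq_choose[OF r rec] by (metis of_nat_mult)
  then have "real r * real (positive_count x r) = real (Suc ?m choose r) * real r / real (Suc ?m)"
    by (simp add: eq_divide_eq mult_ac del: of_nat_Suc)
  also note choose_quotient[OF r]
  finally show ?thesis
    using b by (simp add: positive_ratio_def)
qed

text \<open>Writing \<open>m = r x - t\<close> and clearing denominators reduces the claim to
  \<open>t < x\<close>, which holds as \<open>t < 1 < x\<close>.\<close>

lemma floor_mult_ratio_less:
  assumes r: "r \<ge> 1"
  shows "real (floor_mult x r) / (real (floor_mult x r) - real r + 1) < x / (x - 1)"
proof -
  define t where "t = real r * x - real (floor_mult x r)"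
  have t: "t < 1" using less_floor_mult[of r] by (simp add: t_def)
  have m: "real (floor_mult x r) = real r * x - t" by (simp add: t_def)
  have "real (floor_mult x r) - real r + 1 > 0"
    using le_floor_mult[of r] by simp
  moreover have "t * 1 < x"  using t gt1 by simp
  ultimately show ?thesis
    using gt1 unfolding m by (simp add: divide_simps) (simp add: algebra_simps)
qed

lemma tendsto_floor_mult_ratio:
  "(\<lambda>r. real (floor_mult x r) / (real (floor_mult x r) - real r + 1)) \<longlonglongrightarrow> x / (x - 1)"
proof -
  have lim: "(\<lambda>r. real (floor_mult x r) / real r) \<longlonglongrightarrow> x"
  proof (rule tendsto_sandwich)
    show "(\<lambda>r. x - 1 / real r) \<longlonglongrightarrow> x"
      using tendsto_diff[OF tendsto_const lim_1_over_n, of x] by simp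
    show "\<forall>\<^sub>F r in sequentially. x - 1 / real r \<le> real (floor_mult x r) / real r"
      using eventually_ge_at_top[of 1]
    proof eventually_elim
      case (elim r)
      have "x - 1 / real r = (real r * x - 1) / real r"
        using elim by (simp add: field_simps)
      also have "\<dots> \<le> real (floor_mult x r) / real r"
        using less_floor_mult[of r] by (intro divide_right_mono) auto
      finally show ?case .
    qed
    show "\<forall>\<^sub>F r in sequentially. real (floor_mult x r) / real r \<le> x"
      using eventually_ge_at_top[of 1]
    proof eventually_elim
      case (elim r)
      then show ?case using floor_mult_less[of r] by (simp add: field_simps)
    qed
  qed simp
  have "(\<lambda>r. (real (floor_mult x r) / real r) / (real (floor_mult x r) / real r - 1 + 1 / real r))
      \<longlonglongrightarrow> x / (x - 1 + 0)"
    using gt1 by (intro tendsto_intros lim lim_1_over_n) auto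
  moreover have "\<forall>\<^sub>F r in sequentially.
      (real (floor_mult x r) / real r) / (real (floor_mult x r) / real r - 1 + 1 / real r)
      = real (floor_mult x r) / (real (floor_mult x r) - real r + 1)"
    using eventually_ge_at_top[of 1]
  proof eventually_elim
    case (elim r)
    have "real (floor_mult x r) / real r - 1 + 1 / real r = (real (floor_mult x r) - real r + 1) / real r"
      using elim by (simp add: field_simps)
    then show ?case using elim by simp
  qed
  ultimately have "(\<lambda>r. real (floor_mult x r) / (real (floor_mult x r) - real r + 1)) \<longlonglongrightarrow> x / (x - 1 + 0)"
    by (rule Lim_transform_eventually)
  then show ?thesis
    by simp
qed

end

section \<open>Intermediate convergents\<close>

text \<open>Numerators of the convergents, shifted like \<open>cf_denom_shift\<close>: index 0
  belongs to the formal numerator 1 at index -1.\<close>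

fun cf_num_shift :: "real \<Rightarrow> nat \<Rightarrow> int" where
  "cf_num_shift x 0 = 1"
| "cf_num_shift x (Suc 0) = int (cf_coeff x 0)"
| "cf_num_shift x (Suc (Suc n)) = int (cf_coeff x (Suc n)) * cf_num_shift x (Suc n) + cf_num_shift x n"

text \<open>The sign follows the side of \<open>x\<close> on which the convergent lies, which makes
  the error positive, see \<open>cf_err_pos\<close>.\<close>

definition cf_err :: "real \<Rightarrow> nat \<Rightarrow> real" where
  "cf_err x n = (-1) ^ Suc n * (real (cf_denom_shift x n) * x - of_int (cf_num_shift x n))"

text \<open>Because of the index shift, \<open>semi_denom x k s\<close> is \<open>s Q\<^sub>k + Q\<^sub>k\<^sub>-\<^sub>1\<close>.\<close>

definition semi_denom :: "real \<Rightarrow> nat \<Rightarrow> nat \<Rightarrow> nat" where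
  "semi_denom x n s = s * cf_denom_shift x (Suc n) + cf_denom_shift x n"

text \<open>The error belonging to \<open>semi_denom x n s\<close>. Consecutive convergents lie on
  opposite sides of \<open>x\<close>, so adding one denominator subtracts one error.\<close>

definition semi_err :: "real \<Rightarrow> nat \<Rightarrow> nat \<Rightarrow> real" where
  "semi_err x n s = cf_err x n - real s * cf_err x (Suc n)"

text \<open>One step of the recursion only flips the sign. Consecutive convergents therefore span
  the integer lattice.\<close>

lemma cf_determinant:
  "cf_num_shift x (Suc n) * int (cf_denom_shift x n) - cf_num_shift x n * int (cf_denom_shift x (Suc n))
    = (-1) ^ Suc n"
proof (induction n)
  case (Suc n)
  have "cf_num_shift x (Suc (Suc n)) * int (cf_denom_shift x (Suc n))
      - cf_num_shift x (Suc n) * int (cf_denom_shift x (Suc (Suc n)))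
    = - (cf_num_shift x (Suc n) * int (cf_denom_shift x n) - cf_num_shift x n * int (cf_denom_shift x (Suc n)))"
    by (simp add: algebra_simps)
  then show ?case
    by (simp only: Suc.IH) simp
qed simp

lemma cf_err_rec:
  "cf_err x (Suc (Suc n)) = cf_err x n - real (cf_coeff x (Suc n)) * cf_err x (Suc n)"
  by (simp add: cf_err_def algebra_simps)

context
  fixes x :: real
  assumes irr: "x \<notin> \<rat>" and gt1: "x > 1"
begin

lemma complete_quotient_irrational: "complete_quotient x n \<notin> \<rat>"
proof (induction n)
  case 0
  then show ?case using irr by simp
next
  case (Suc n)
  show ?case
  proof
    assume "complete_quotient x (Suc n) \<in> \<rat>"
    then have "inverse (complete_quotient x (Suc n)) \<in> \<rat>"
      by (rule Rats_inverse)
    then have "frac (complete_quotient x n) \<in> \<rat>"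
      by simp
    then have "frac (complete_quotient x n) + of_int \<lfloor>complete_quotient x n\<rfloor> \<in> \<rat>"
      by (intro Rats_add) auto
    then show False
      using Suc.IH by (simp add: frac_def)
  qed
qed

lemma frac_complete_quotient_pos: "frac (complete_quotient x n) > 0"
  using complete_quotient_irrational[of n] Ints_subset_Rats by auto

lemma complete_quotient_gt_1: "complete_quotient x n > 1"
proof (cases n)
  case (Suc k)
  then show ?thesis
    using frac_complete_quotient_pos[of k] frac_lt_1[of "complete_quotient x k"] by simp
qed (use gt1 in simp)

lemma of_nat_cf_coeff: "real (cf_coeff x n) = of_int \<lfloor>complete_quotient x n\<rfloor>"
  using complete_quotient_gt_1[of n] by (simp add: cf_coeff_def)

lemma cf_coeff_ge_1: "cf_coeff x n \<ge> 1"
  using complete_quotient_gt_1[of n] by (simp add: cf_coeff_def le_nat_iff le_floor_iff)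

text \<open>The errors run through the Euclidean algorithm: the next error is the remainder, namely
  the fractional part of the complete quotient times the current error.\<close>

lemma cf_err_quotient:
  "cf_err x (Suc n) > 0 \<and> cf_err x n = complete_quotient x (Suc n) * cf_err x (Suc n)"
proof (induction n)
  case 0
  have "cf_err x (Suc 0) = frac x"
    using of_nat_cf_coeff[of 0] by (simp add: cf_err_def frac_def)
  then show ?case
    using frac_complete_quotient_pos[of 0] by (simp add: cf_err_def)
next
  case (Suc n)
  have f: "cf_err x (Suc (Suc n)) = frac (complete_quotient x (Suc n)) * cf_err x (Suc n)"
    using Suc.IH unfolding cf_err_rec frac_def of_nat_cf_coeff by (simp add: algebra_simps)
  then show ?case
    using Suc.IH frac_complete_quotient_pos[of "Suc n"] by simp
qed

lemma cf_err_pos: "cf_err x n > 0"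
proof -
  have "0 < complete_quotient x (Suc n) * cf_err x (Suc n)"
    using cf_err_quotient[of n] complete_quotient_gt_1[of "Suc n"]
    by (intro mult_pos_pos) (auto simp del: complete_quotient.simps)
  then show ?thesis
    using cf_err_quotient[of n] by (simp del: complete_quotient.simps)
qed

lemma semi_err_pos:
  assumes "s \<le> cf_coeff x (Suc n)"
  shows "semi_err x n s > 0"
proof -
  have "real s * cf_err x (Suc n) \<le> real (cf_coeff x (Suc n)) * cf_err x (Suc n)"
    using assms cf_err_pos[of "Suc n"] by (intro mult_right_mono) auto
  then show ?thesis
    using cf_err_pos[of "Suc (Suc n)"] unfolding cf_err_rec semi_err_def by linarith
qed

lemma semi_err_Suc_less: "semi_err x n (Suc s) < semi_err x n s"
  using cf_err_pos[of "Suc n"] by (simp add: semi_err_def algebra_simps)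

text \<open>The family for \<open>n\<close> ends where the family for \<open>n + 2\<close> begins,
  so families of equal parity join into one chain.\<close>

lemma semi_coeff:
  "semi_denom x n (cf_coeff x (Suc n)) = semi_denom x (Suc (Suc n)) 0"
  "semi_err x n (cf_coeff x (Suc n)) = semi_err x (Suc (Suc n)) 0"
  by (simp_all add: semi_denom_def semi_err_def cf_err_rec)

lemma cf_denom_shift_pos: "cf_denom_shift x (Suc n) \<ge> 1"
proof (induction n rule: less_induct)
  case (less n)
  show ?case
  proof (cases n)
    case (Suc k)
    then show ?thesis
      using less.IH[of k] cf_coeff_ge_1[of "Suc k"] by (simp add: Suc_le_eq)
  qed simp
qed

lemma cf_denom_shift_ge: "n \<le> cf_denom_shift x (Suc n)"
proof (induction n rule: less_induct)
  case (less n)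
  show ?case
  proof (cases "n \<le> 1")
    case True
    then show ?thesis using cf_denom_shift_pos[of n] by simp
  next
    case False
    then obtain k where k: "n = Suc (Suc k)"
      by (metis One_nat_def Suc_le_D not_less_eq_eq)
    have "Suc k \<le> cf_denom_shift x (Suc (Suc k))"
      using less.IH[of "Suc k"] k by simp
    also have "\<dots> \<le> cf_coeff x (Suc (Suc k)) * cf_denom_shift x (Suc (Suc k))"
      using cf_coeff_ge_1[of "Suc (Suc k)"] by simp
    finally show ?thesis
      using cf_denom_shift_pos[of k] k by simp
  qed
qed

section \<open>One-sided best approximation\<close>

lemma semi_lattice_vector:
  "semi_err x n s = (-1) ^ Suc n * (real (semi_denom x n s) * x
     - of_int (int s * cf_num_shift x (Suc n) + cf_num_shift x n))"
  by (simp add: semi_err_def semi_denom_def cf_err_def algebra_simps)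

text \<open>The error is a positive distance down to some integer, and \<open>frac\<close> takes the
  nearest integer below. For \<open>n = s = 0\<close> the two sides are 0 and 1.\<close>

lemma frac_semi_denom_le:
  assumes "s \<le> cf_coeff x (Suc n)"
  shows "frac (of_int ((-1) ^ Suc n) * (real (semi_denom x n s) * x)) \<le> semi_err x n s"
proof -
  define \<sigma> :: int where "\<sigma> = (-1) ^ Suc n"
  define p where "p = \<sigma> * (int s * cf_num_shift x (Suc n) + cf_num_shift x n)"
  have eq: "semi_err x n s = of_int \<sigma> * (real (semi_denom x n s) * x) - of_int p"
    unfolding semi_lattice_vector p_def \<sigma>_def by (simp add: algebra_simps)
  then have "of_int p \<le> of_int \<sigma> * (real (semi_denom x n s) * x)"
    using semi_err_pos[OF assms] by linarith
  then have "p \<le> \<lfloor>of_int \<sigma> * (real (semi_denom x n s) * x)\<rfloor>"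
    by (simp add: le_floor_iff)
  then show ?thesis
    unfolding eq \<sigma>_def[symmetric] frac_def by simp
qed

text \<open>The vectors with horizontal components \<open>semi_denom x n s\<close> and \<open>cf_denom_shift x (Suc n)\<close>
  form a basis of the lattice of all \<open>(j, j x - p)\<close>; a vector with positive components and
  error below \<open>semi_err x n s\<close> has both coordinates at least 1 in it.\<close>

lemma semi_err_le_frac:
  assumes s: "s < cf_coeff x (Suc n)" and j: "1 \<le> j" "j < semi_denom x n (Suc s)"
  shows "semi_err x n s \<le> frac (of_int ((-1) ^ Suc n) * (real j * x))"
proof (rule ccontr)
  assume less: "\<not> ?thesis"
  define \<sigma> :: int where "\<sigma> = (-1) ^ Suc n"
  have \<sigma>: "\<sigma> * \<sigma> = 1"
    by (simp add: \<sigma>_def flip: power_add mult_2)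
  \<comment> \<open>Chosen so that the signed error \<open>\<sigma> * (j x - p)\<close> is exactly
    the fractional part \<open>y\<close>.\<close>
  define p where "p = \<sigma> * \<lfloor>of_int \<sigma> * (real j * x)\<rfloor>"
  define y where "y = frac (of_int \<sigma> * (real j * x))"
  have "of_int \<sigma> * of_int \<sigma> = (1 :: real)"
    using \<sigma> by (metis of_int_1 of_int_mult)
  then have "of_int \<sigma> * of_int p = (of_int \<lfloor>of_int \<sigma> * (real j * x)\<rfloor> :: real)"
    by (simp add: p_def flip: mult.assoc)
  then have y: "y = of_int \<sigma> * (real j * x - of_int p)"
    by (simp only: y_def frac_def right_diff_distrib)
  have "of_int \<sigma> * (real j * x) \<notin> \<int>"
  proof
    assume "of_int \<sigma> * (real j * x) \<in> \<int>"
    then have "of_int \<sigma> * (of_int \<sigma> * (real j * x)) \<in> \<int>"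
      by (rule Ints_mult[OF Ints_of_int])
    then have "real j * x \<in> \<int>"
      using \<open>of_int \<sigma> * of_int \<sigma> = (1 :: real)\<close> by (simp only: mult.assoc[symmetric] mult_1_left)
    then show False
      using mult_nat_noteq_int[OF irr gt1 j(1)] by (auto elim: Ints_cases)
  qed
  then have ypos: "y > 0"
    by (simp add: y_def)
  define c where "c = int (semi_denom x n s)"
  define P where "P = int s * cf_num_shift x (Suc n) + cf_num_shift x n"
  define B where "B = int (cf_denom_shift x (Suc n))"
  define A where "A = cf_num_shift x (Suc n)"
  define e where "e = semi_err x n s"
  define d where "d = cf_err x (Suc n)"
  have e: "e = of_int \<sigma> * (of_int c * x - of_int P)"
    by (simp only: e_def semi_lattice_vector \<sigma>_def c_def P_def of_int_of_nat_eq of_int_power of_int_minus of_int_1)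
  have d: "d = - of_int \<sigma> * (of_int B * x - of_int A)"
    by (simp add: d_def cf_err_def \<sigma>_def B_def A_def)
  have det: "A * c - P * B = \<sigma>"
    using cf_determinant[of x n]
    by (simp add: A_def B_def c_def P_def \<sigma>_def semi_denom_def algebra_simps)
  \<comment> \<open>Coordinates by Cramer's rule; dividing by the determinant
    \<open>\<sigma>\<close> is multiplying by it, as \<open>\<sigma> * \<sigma> = 1\<close>.\<close>
  define u where "u = \<sigma> * (A * int j - B * p)"
  define v where "v = \<sigma> * (c * p - P * int j)"
  have "u * c + v * B = \<sigma> * (A * c - P * B) * int j"
    by (simp add: u_def v_def algebra_simps)
  then have ju: "int j = u * c + v * B"
    using det \<sigma> by simp
  have "u * P + v * A = \<sigma> * (A * c - P * B) * p"
    by (simp add: u_def v_def algebra_simps)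
  then have pu: "p = u * P + v * A"
    using det \<sigma> by simp
  have "real j = of_int u * of_int c + of_int v * of_int B"
    using ju by (metis of_int_add of_int_mult of_int_of_nat_eq)
  then have yu: "y = of_int u * e - of_int v * d"
    unfolding y e d pu by (simp add: algebra_simps)
  have epos: "e > 0" and dpos: "d > 0"
    using semi_err_pos[of s n] s cf_err_pos[of "Suc n"] by (simp_all add: e_def d_def)
  have c0: "c \<ge> 0" and B1: "B \<ge> 1"
    using cf_denom_shift_pos[of n] by (simp_all add: c_def B_def)
  \<comment> \<open>If \<open>u\<close> were at most 0, then a positive error would force
    \<open>v < 0\<close>, and \<open>j\<close> would be negative.\<close>
  have u1: "u \<ge> 1"
  proof (rule ccontr)
    assume "\<not> u \<ge> 1"
    then have u0: "u \<le> 0" by simp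
    then have "of_int u * e \<le> 0"
      using epos by (simp add: mult_nonpos_nonneg)
    then have "of_int v * d < 0"
      using yu ypos by simp
    then have "v < 0"
      using dpos by (simp add: mult_less_0_iff)
    then have "u * c + v * B < 0"
      using u0 c0 B1 by (smt (verit) mult_nonpos_nonneg mult_neg_pos)
    then show False using ju by simp
  qed
  \<comment> \<open>As \<open>u * e\<close> is already at least \<open>e\<close>, an error below
    \<open>e\<close> needs a positive \<open>v\<close>.\<close>
  have "y < e"
    using less by (simp add: y_def e_def \<sigma>_def)
  moreover have "e \<le> of_int u * e"
    using u1 epos by simp
  ultimately have "of_int v * d > 0"
    using yu by simp
  then have v1: "v \<ge> 1"
    using dpos by (simp add: zero_less_mult_iff)
  have "c + B \<le> u * c + v * B"
  proof -
    have "1 * c \<le> u * c" "1 * B \<le> v * B"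
      using u1 v1 c0 B1 by (auto intro!: mult_right_mono simp del: mult_1_left)
    then show ?thesis by linarith
  qed
  then have "int (semi_denom x n (Suc s)) \<le> int j"
    unfolding ju by (simp add: c_def B_def semi_denom_def)
  then show False
    using j by simp
qed

text \<open>The lower bound \<open>semi_err x n s\<close> holds for all smaller \<open>j\<close>,
  and moving on to \<open>Suc s\<close> makes the error strictly smaller than it.\<close>

lemma frac_record_semi_denom:
  assumes s: "s < cf_coeff x (Suc n)"
  shows "frac_record x ((-1) ^ Suc n) (semi_denom x n (Suc s))"
  unfolding frac_record_def
proof (intro allI impI)
  fix j assume j: "1 \<le> j \<and> j < semi_denom x n (Suc s)"
  have "frac (of_int ((-1) ^ Suc n) * (real (semi_denom x n (Suc s)) * x)) \<le> semi_err x n (Suc s)"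
    using s by (intro frac_semi_denom_le) simp
  also note semi_err_Suc_less
  also have "semi_err x n s \<le> frac (of_int ((-1) ^ Suc n) * (real j * x))"
    using semi_err_le_frac[OF s] j by blast
  finally show "frac (of_int ((-1) ^ Suc n) * (real (semi_denom x n (Suc s)) * x))
      < frac (of_int ((-1) ^ Suc n) * (real j * x))" .
qed

text \<open>The case \<open>s = 0\<close> is the last member of the family for \<open>n - 2\<close>.
  For \<open>n = 1\<close> the denominator is 1 and the record is vacuous; the excluded pair has
  denominator 0.\<close>

lemma frac_record_semi_denom_all:
  assumes s: "s < cf_coeff x (Suc n)" and n: "(n, s) \<noteq> (0, 0)"
  shows "semi_denom x n s \<ge> 1 \<and> frac_record x ((-1) ^ Suc n) (semi_denom x n s)"
proof (cases s)
  case (Suc t)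
  have "semi_denom x n (Suc t) \<ge> 1"
    using cf_denom_shift_pos[of n] by (simp add: semi_denom_def)
  then show ?thesis
    using frac_record_semi_denom[of t n] s Suc by simp
next
  case 0
  then have "n \<noteq> 0" using n by simp
  then consider "n = 1" | k where "n = Suc (Suc k)"
    by (metis One_nat_def not0_implies_Suc)
  then show ?thesis
  proof cases
    case 1
    then show ?thesis
      using 0 by (simp add: semi_denom_def frac_record_def)
  next
    case 2
    have "frac_record x ((-1) ^ Suc k) (semi_denom x k (Suc (cf_coeff x (Suc k) - 1)))"
      using cf_coeff_ge_1[of "Suc k"] by (intro frac_record_semi_denom) simp
    then show ?thesis
      using 2 0 cf_coeff_ge_1[of "Suc k"] cf_denom_shift_pos[of "Suc k"]
      by (simp add: semi_coeff semi_denom_def)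
  qed
qed

text \<open>The chain of odd families cuts the positive integers into intervals; strictly inside an
  interval the left end point has a fractional part at most as large, so no record occurs
  there.\<close>

lemma frac_record_imp_semi_denom:
  assumes r: "r \<ge> 1" and rec: "frac_record x 1 r"
  shows "\<exists>n s. odd n \<and> s < cf_coeff x (Suc n) \<and> r = semi_denom x n s"
proof -
  let ?Q = "cf_denom_shift x"
  \<comment> \<open>Selects the odd family whose range, from shifted index \<open>2 * k + 1\<close>
    to \<open>2 * k + 3\<close>, contains \<open>r\<close>.\<close>
  define k where "k = (LEAST k. r < ?Q (2 * k + 3))"
  have "r < ?Q (2 * r + 3)"
    using cf_denom_shift_ge[of "2 * r + 2"] by (simp add: numeral_3_eq_3)
  then have k: "r < ?Q (2 * k + 3)"
    unfolding k_def by (rule LeastI)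
  have k': "?Q (2 * k + 1) \<le> r"
  proof (cases k)
    case 0
    then show ?thesis using r by simp
  next
    case (Suc l)
    have "\<not> r < ?Q (2 * l + 3)"
      using not_less_Least[of l "\<lambda>k. r < ?Q (2 * k + 3)"] Suc by (simp add: k_def)
    then show ?thesis
      using Suc by (simp add: numeral_3_eq_3)
  qed
  define n where "n = 2 * k + 1"
  \<comment> \<open>Division with remainder locates \<open>r\<close> between consecutive members of
    the family.\<close>
  define s where "s = (r - ?Q n) div ?Q (Suc n)"
  have Qpos: "?Q (Suc n) > 0"
    using cf_denom_shift_pos[of n] by simp
  have "2 * k + 3 = Suc (Suc n)"
    by (simp add: n_def)
  then have "r < cf_coeff x (Suc n) * ?Q (Suc n) + ?Q n"
    using k by (simp only: cf_denom_shift.simps)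
  then have "r - ?Q n < cf_coeff x (Suc n) * ?Q (Suc n)"
    using k' by (simp add: n_def)
  then have s: "s < cf_coeff x (Suc n)"
    using Qpos by (simp add: s_def div_less_iff_less_mult)
  have dm: "s * ?Q (Suc n) + (r - ?Q n) mod ?Q (Suc n) = r - ?Q n"
    unfolding s_def by (rule div_mult_mod_eq)
  have "(r - ?Q n) mod ?Q (Suc n) < ?Q (Suc n)"
    using Qpos by simp
  then have lo: "semi_denom x n s \<le> r" and hi: "r < semi_denom x n (Suc s)"
    using dm k' unfolding semi_denom_def n_def[symmetric] by simp_all
  have "semi_denom x n s = r"
  proof (rule ccontr)
    assume "semi_denom x n s \<noteq> r"
    then have lt: "semi_denom x n s < r" using lo by simp
    have "semi_denom x n s \<ge> 1"
      using frac_record_semi_denom_all[OF s] by (simp add: n_def)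
    then have "frac (real r * x) < frac (real (semi_denom x n s) * x)"
      using rec lt by (simp add: frac_record_def)
    moreover have "frac (real (semi_denom x n s) * x) \<le> semi_err x n s"
      using frac_semi_denom_le[of s n] s by (simp add: n_def)
    moreover have "semi_err x n s \<le> frac (real r * x)"
      using semi_err_le_frac[OF s r hi] by (simp add: n_def)
    ultimately show False by linarith
  qed
  then show ?thesis
    using s n_def by (intro exI[of _ n] exI[of _ s]) auto
qed

end

lemma cf_denom_eq_shift:
  "cf_denom x (int k) = cf_denom_shift x (Suc k)" "cf_denom x (int k - 1) = cf_denom_shift x k"
  by (simp_all add: cf_denom_def nat_add_distrib)

lemma lower_indices_eq:
  "lower_indices q = {semi_denom (alpha_q q) n s | s n. odd n \<and> s < cf_coeff (alpha_q q) (Suc n)}"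
proof -
  have "Suc 0 \<le> k \<and> odd k \<and> P \<longleftrightarrow> odd k \<and> P" for k :: nat and P
    by (cases k) auto
  then show ?thesis
    by (simp add: lower_indices_def semi_denom_def cf_denom_eq_shift)
qed

lemma upper_indices_eq:
  "upper_indices q =
    {semi_denom (alpha_q q) n s | s n. even n \<and> s < cf_coeff (alpha_q q) (Suc n) \<and> (n, s) \<noteq> (0, 0)}"
  by (simp add: upper_indices_def semi_denom_def cf_denom_eq_shift)

section \<open>Admissible words\<close>

text \<open>A fraction \<open>a / b\<close> would give \<open>q ^ b = 2 ^ a\<close> with
  \<open>a > 0\<close>, an odd number equal to an even one.\<close>

lemma alpha_q_irrational:
  assumes "odd q" "q \<ge> 3"
  shows "alpha_q q \<notin> \<rat>"
proof
  assume "alpha_q q \<in> \<rat>"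
  then obtain a b :: nat where b: "b \<noteq> 0" and ab: "\<bar>alpha_q q\<bar> = real a / real b"
    using Rats_abs_nat_div_natE by metis
  have pos: "alpha_q q > 0"
    using assms by (simp add: alpha_q_def)
  then have eq: "real b * alpha_q q = real a"
    using ab b by (simp add: field_simps)
  moreover have "real b * alpha_q q > 0"
    using pos b by simp
  ultimately have "a \<noteq> 0"
    by auto
  have "real q ^ b = (2 powr alpha_q q) powr real b"
    using assms by (simp add: alpha_q_def powr_realpow)
  also have "\<dots> = 2 powr (real b * alpha_q q)"
    by (simp add: powr_powr mult.commute)
  also have "\<dots> = 2 ^ a"
    unfolding eq by (simp add: powr_realpow)
  finally have "q ^ b = 2 ^ a"
    by (metis of_nat_eq_iff of_nat_numeral of_nat_power)
  moreover have "odd (q ^ b)"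
    using assms by simp
  ultimately show False
    using \<open>a \<noteq> 0\<close> by simp
qed

lemma alpha_q_gt_1:
  assumes "q \<ge> 3"
  shows "alpha_q q > 1"
  using assms by (simp add: alpha_q_def)

definition letter :: "nat \<Rightarrow> bool \<Rightarrow> real" where
  "letter q b = (if b then real q / 2 else 1 / 2)"

lemma prod_list_letter:
  assumes "q \<ge> 3"
  shows "prod_list (map (letter q) v) = 2 powr hgt (alpha_q q) v"
proof (induction v)
  case (Cons b v)
  have "letter q b = 2 powr (if b then alpha_q q - 1 else - 1)"
    using assms by (simp add: letter_def alpha_q_def powr_diff powr_minus)
  then show ?case
    using Cons.IH by (simp add: powr_add)
qed simp

lemma admissible_letter_iff:
  assumes "q \<ge> 3"
  shows "admissible q r (map (letter q) v) \<longleftrightarrow> count_list v True = r \<and> first_passage (alpha_q q) v"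
proof -
  have inj: "inj (letter q)"
    using assms by (auto simp: inj_def letter_def)
  have "count_list (map (letter q) v) (real q / 2) = count_list v True"
    using count_list_map_conv[OF inj, of v True] by (simp add: letter_def)
  moreover have "set (map (letter q) v) \<subseteq> {real q / 2, 1 / 2}"
    by (auto simp: letter_def)
  moreover have "prod_list (take l (map (letter q) v)) > 1 \<longleftrightarrow> hgt (alpha_q q) (take l v) > 0" for l
    unfolding take_map prod_list_letter[OF assms] using powr_less_cancel_iff[of 2 0] by simp
  moreover have "prod_list (map (letter q) v) < 1 \<longleftrightarrow> hgt (alpha_q q) v < 0"
    unfolding prod_list_letter[OF assms] using powr_less_cancel_iff[of 2 _ 0] by simp
  ultimately show ?thesis
    by (simp add: admissible_def first_passage_def)
qed

lemma admissible_words: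
  assumes "q \<ge> 3"
  shows "{w. admissible q r w} = map (letter q) ` {v. count_list v True = r \<and> first_passage (alpha_q q) v}"
proof -
  have "w \<in> range (map (letter q))" if "admissible q r w" for w
  proof -
    have "set w \<subseteq> range (letter q)"
      using that by (auto simp: admissible_def letter_def image_iff)
    then have "w \<in> lists (range (letter q))"
      by (simp add: lists_eq_set)
    then show ?thesis
      by (simp only: lists_image lists_UNIV)
  qed
  then show ?thesis
    unfolding admissible_letter_iff[OF assms, symmetric] by blast
qed

lemma a_q_eq:
  assumes "odd q" "q \<ge> 3" "r \<ge> 1"
  shows "a_q q r = positive_count (alpha_q q) r"
proof -
  have "inj (letter q)"
    using assms by (auto simp: inj_def letter_def)
  then have "inj_on (map (letter q)) {v. count_list v True = r \<and> first_passage (alpha_q q) v}"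
    by (auto intro: inj_on_subset[of _ UNIV])
  then have "a_q q r = card {v. count_list v True = r \<and> first_passage (alpha_q q) v}"
    unfolding a_q_def admissible_words[OF assms(2)] by (rule card_image)
  then show ?thesis
    using card_first_passage_words[OF alpha_q_irrational[OF assms(1,2)] alpha_q_gt_1[OF assms(2)] assms(3)]
    by simp
qed

lemma m_q_eq: "m_q q r = floor_mult (alpha_q q) r"
  by (simp add: m_q_def floor_mult_def)

lemma R_q_eq:
  assumes "odd q" "q \<ge> 3" "r \<ge> 1"
  shows "R_q q r = positive_ratio (alpha_q q) r"
  unfolding R_q_def positive_ratio_def a_q_eq[OF assms] m_q_eq ..

section \<open>The index sets as records\<close>

lemma lower_indices_frac_record:
  assumes "odd q" "q \<ge> 3"
  shows "lower_indices q = {r. r \<ge> 1 \<and> frac_record (alpha_q q) 1 r}"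
proof -
  note irr = alpha_q_irrational[OF assms] and gt1 = alpha_q_gt_1[OF assms(2)]
  show ?thesis
  proof (intro set_eqI iffI)
    fix r assume "r \<in> lower_indices q"
    then obtain s n where "odd n" "s < cf_coeff (alpha_q q) (Suc n)" "r = semi_denom (alpha_q q) n s"
      by (auto simp: lower_indices_eq)
    then show "r \<in> {r. r \<ge> 1 \<and> frac_record (alpha_q q) 1 r}"
      using frac_record_semi_denom_all[OF irr gt1, of s n] by (cases n) auto
  next
    fix r assume "r \<in> {r. r \<ge> 1 \<and> frac_record (alpha_q q) 1 r}"
    then show "r \<in> lower_indices q"
      using frac_record_imp_semi_denom[OF irr gt1, of r] by (auto simp: lower_indices_eq)
  qed
qed

lemma upper_indices_frac_record:
  assumes "odd q" "q \<ge> 3" "r \<in> upper_indices q"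
  shows "r \<ge> 1 \<and> frac_record (alpha_q q) (- 1) r"
proof -
  obtain n s where "even n" "s < cf_coeff (alpha_q q) (Suc n)" "(n, s) \<noteq> (0, 0)"
    and r: "r = semi_denom (alpha_q q) n s"
    using assms(3) by (auto simp: upper_indices_eq)
  then show ?thesis
    using frac_record_semi_denom_all[OF alpha_q_irrational[OF assms(1,2)] alpha_q_gt_1[OF assms(2)], of s n]
    by simp
qed

lemma infinite_indices:
  assumes "odd q" "q \<ge> 3"
  shows "infinite (lower_indices q)" "infinite (upper_indices q)"
proof -
  note irr = alpha_q_irrational[OF assms] and gt1 = alpha_q_gt_1[OF assms(2)]
  have pos: "cf_coeff (alpha_q q) n > 0" for n
    using cf_coeff_ge_1[OF irr gt1, of n] by simp
  have ge: "n < semi_denom (alpha_q q) (n + 2) 0" for n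
    using cf_denom_shift_ge[OF irr gt1, of "n + 1"] by (simp add: semi_denom_def)
  \<comment> \<open>With \<open>s = 0\<close> the members are denominators of convergents, which
    grow without bound.\<close>
  have "semi_denom (alpha_q q) (2 * n + 1 + 2) 0 \<in> lower_indices q" for n
    unfolding lower_indices_eq by (intro CollectI exI conjI) (rule refl, simp, rule pos)
  moreover have "n < semi_denom (alpha_q q) (2 * n + 1 + 2) 0" for n
    using ge[of "2 * n + 1"] by linarith
  ultimately show "infinite (lower_indices q)"
    unfolding infinite_nat_iff_unbounded by blast
  \<comment> \<open>The index is even and positive, which avoids the excluded pair.\<close>
  have "semi_denom (alpha_q q) (2 * n + 2) 0 \<in> upper_indices q" for n
    unfolding upper_indices_eq by (intro CollectI exI conjI) (rule refl, simp, rule pos, simp)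
  moreover have "n < semi_denom (alpha_q q) (2 * n + 2) 0" for n
    using ge[of "2 * n"] by linarith
  ultimately show "infinite (upper_indices q)"
    unfolding infinite_nat_iff_unbounded by blast
qed

text \<open>Limits along an infinite index set are taken in this filter; its nontriviality lets a
  limit determine \<open>Limsup\<close>.\<close>

lemma subset_sequentially_neq_bot:
  fixes S :: "nat set"
  assumes "infinite S"
  shows "inf sequentially (principal S) \<noteq> bot"
proof -
  have "\<exists>n. N \<le> n \<and> n \<in> S" for N
    using assms by (meson infinite_nat_iff_unbounded_le)
  then show ?thesis
    by (auto simp: trivial_limit_def eventually_inf_principal eventually_sequentially)
qed

theorem corollary12:
  fixes q :: nat
  assumes "odd q" and "q \<ge> 3"
  shows "liminf (\<lambda>r. ereal (R_q q r)) = 1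
    \<and> limsup (\<lambda>r. ereal (R_q q r)) = ereal (alpha_q q / (alpha_q q - 1))
    \<and> {r. r \<ge> 1 \<and> R_q q r = 1} = lower_indices q
    \<and> (\<forall>r \<in> upper_indices q. R_q q r = real (m_q q r) / (real (m_q q r) - real r + 1))
    \<and> infinite (upper_indices q)
    \<and> (R_q q \<longlongrightarrow> alpha_q q / (alpha_q q - 1)) (inf sequentially (principal (upper_indices q)))
    \<and> (\<forall>r \<ge> 1. R_q q r < alpha_q q / (alpha_q q - 1))"
proof (intro conjI)
  define \<alpha> where "\<alpha> = alpha_q q"
  have irr: "\<alpha> \<notin> \<rat>" and gt1: "\<alpha> > 1"
    using alpha_q_irrational alpha_q_gt_1 assms by (simp_all add: \<alpha>_def)
  note R = R_q_eq[OF assms, folded \<alpha>_def]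
  let ?F = "inf sequentially (principal (upper_indices q))"
  show upper: "\<forall>r \<in> upper_indices q. R_q q r = real (m_q q r) / (real (m_q q r) - real r + 1)"
    using upper_indices_frac_record[OF assms] R positive_ratio_eq[OF irr gt1]
    by (simp add: m_q_eq \<alpha>_def)
  show less: "\<forall>r \<ge> 1. R_q q r < alpha_q q / (alpha_q q - 1)"
    unfolding \<alpha>_def[symmetric]
    using R order.strict_trans1[OF positive_ratio_le[OF irr gt1] floor_mult_ratio_less[OF irr gt1]] by simp
  show eq: "{r. r \<ge> 1 \<and> R_q q r = 1} = lower_indices q"
    unfolding lower_indices_frac_record[OF assms] \<alpha>_def[symmetric]
    using R positive_ratio_eq_1_iff[OF irr gt1] by auto
  show inf: "infinite (upper_indices q)"
    by (rule infinite_indices(2)[OF assms])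
  show lim: "(R_q q \<longlongrightarrow> alpha_q q / (alpha_q q - 1)) ?F"
  proof (rule Lim_transform_eventually)
    show "((\<lambda>r. real (m_q q r) / (real (m_q q r) - real r + 1)) \<longlongrightarrow> alpha_q q / (alpha_q q - 1)) ?F"
      using tendsto_floor_mult_ratio[OF irr gt1] unfolding m_q_eq \<alpha>_def
      by (rule tendsto_mono[OF inf_le1])
    show "\<forall>\<^sub>F r in ?F. real (m_q q r) / (real (m_q q r) - real r + 1) = R_q q r"
      using upper by (simp add: eventually_inf_principal)
  qed
  show "liminf (\<lambda>r. ereal (R_q q r)) = 1"
  proof (rule antisym)
    show "1 \<le> liminf (\<lambda>r. ereal (R_q q r))"
    proof (rule Liminf_bounded)
      show "\<forall>\<^sub>F r in sequentially. 1 \<le> ereal (R_q q r)"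
        using eventually_ge_at_top[of 1]
        by eventually_elim (use R positive_ratio_ge_1[OF irr gt1] in auto)
    qed
    \<comment> \<open>The value 1 recurs in every tail, so every tail infimum is at most 1.\<close>
    have "\<exists>r\<ge>N. R_q q r = 1" for N
      using infinite_indices(1)[OF assms] unfolding eq[symmetric] infinite_nat_iff_unbounded_le by blast
    then show "liminf (\<lambda>r. ereal (R_q q r)) \<le> 1"
      unfolding liminf_SUP_INF
      by (intro SUP_least) (metis INF_lower2 atLeast_iff one_ereal_def order_refl)
  qed
  show "limsup (\<lambda>r. ereal (R_q q r)) = ereal (alpha_q q / (alpha_q q - 1))"
  proof (rule antisym)
    show "limsup (\<lambda>r. ereal (R_q q r)) \<le> ereal (alpha_q q / (alpha_q q - 1))"
    proof (rule Limsup_bounded)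
      show "\<forall>\<^sub>F r in sequentially. ereal (R_q q r) \<le> ereal (alpha_q q / (alpha_q q - 1))"
        using eventually_ge_at_top[of 1]
        by eventually_elim (use less in \<open>auto intro: less_imp_le\<close>)
    qed
    \<comment> \<open>The limit along the upper indices is a \<open>Limsup\<close> over a finer
      filter, hence a lower bound for the full \<open>limsup\<close>.\<close>
    have "Limsup ?F (\<lambda>r. ereal (R_q q r)) = ereal (alpha_q q / (alpha_q q - 1))"
      using lim by (intro lim_imp_Limsup subset_sequentially_neq_bot inf) simp
    moreover have "Limsup ?F (\<lambda>r. ereal (R_q q r)) \<le> limsup (\<lambda>r. ereal (R_q q r))"
      unfolding Limsup_def
      by (rule INF_superset_mono) (auto intro: filter_leD[OF inf_le1])
    ultimately show "ereal (alpha_q q / (alpha_q q - 1)) \<le> limsup (\<lambda>r. ereal (R_q q r))"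
      by simp
  qed
qed

end
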